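(* Let $(w_n)_{n\ge 1}$ be a sequence of positive real weights. Denote by $\mathcal{B}_n^w$ the number of branches in a weighted recursive tree $\mathcal{T}_n^w$ of size $n$ with these weights, and let $\mathcal{G}$ be a standard normal random variable. (i) For all $n\ge 2$, $$\mathbb{E}[\mathcal{B}_n^w] = \sum_{i=1}^{n-1} \frac{w_1}{\sum_{k=1}^i w_k} \qquad \text{and} \qquad \mathrm{Var}(\mathcal{B}_n^w) = \sum_{i=2}^{n-1} \frac{w_1}{\sum_{k=1}^i w_k} \left( 1-\frac{w_1}{ \sum_{k=1}^i w_k }\right).$$ (ii) If $\mathbb{E}[\mathcal{B}_n^w]$ diverges (to $\infty$) as $n\to\infty$, then $$\frac{\mathcal{B}_n^w - \mathbb{E}[\mathcal{B}_n^w]}{\sqrt{\mathrm{Var}(\mathcal{B}_n^w)}} \longrightarrow \mathcal{G} \quad\text{in distribution as } n\to\infty.$$ (iii) For all $n\ge 3$, $$d_W \left(\frac{\mathcal{B}_n^w - \mathbb{E}[\mathcal{B}_n^w]}{\sqrt{\mathrm{Var}(\mathcal{B}_n^w)}},\ \mathcal{G} \right) \leq \frac{1}{\sqrt{\mathrm{Var}(\mathcal{B}_n^w)}}\cdot \frac{\sqrt{28} + \sqrt{\pi}}{\sqrt{\pi}}.$$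
   Context: Weighted recursive tree (WRT): given positive weights $(w_i)_{i\ge 1}$, the WRT $\mathcal{T}_n^w$ of size $n$ is the random rooted tree on nodes $1,\dots,n$ built as follows. Node $1$ is the root; for $j=2,\dots,n$ successively and independently of the previous steps, node $j$ is attached as a child to node $i\in\{1,\dots,j-1\}$ with probability $\frac{w_i}{w_1+\cdots+w_{j-1}}$. The number of branches of a rooted tree is the number of children of the root. $d_W(X,Y)=\sup_h |\mathbb{E}[h(X)]-\mathbb{E}[h(Y)]|$, the supremum over all $1$-Lipschitz $h:\mathbb{R}\to\mathbb{R}$, is the Wasserstein distance between the laws of $X$ and $Y$. *)

theory Defs
  imports "HOL-Probability.Probability"
begin

text \<open>
  A tree on the nodes \<open>1, \<dots>, n\<close> with root \<open>1\<close> is encoded by the set of its arcs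
  \<open>(parent, child)\<close>. Its node set is known from \<open>n\<close>; in particular the tree
  consisting of the root alone is \<open>{}\<close>.
\<close>

type_synonym tree = "(nat \<times> nat) set"

definition children :: "tree \<Rightarrow> nat \<Rightarrow> nat set" where
  "children t v = {c. (v, c) \<in> t}"

definition branches :: "tree \<Rightarrow> nat" where
  "branches t = card (children t 1)"

text \<open>
  Law of the parent of node \<open>m + 1\<close>. Weights are indexed from \<open>1\<close>; the value \<open>w 0\<close> is
  never used. The definition is meaningful for \<open>m \<ge> 1\<close> and positive weights, see
  \<open>pmf_attachment\<close> below.
\<close>

definition attachment :: "(nat \<Rightarrow> real) \<Rightarrow> nat \<Rightarrow> nat pmf" where
  "attachment w m = embed_pmf (\<lambda>i. if i \<in> {1..m} then w i / (\<Sum>k=1..m. w k) else 0)"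

text \<open>
  Each step draws the new parent from a distribution that does not depend on the
  tree built so far, which expresses the independence of the steps. Size \<open>0\<close> is a dummy case.
\<close>

fun wrt :: "(nat \<Rightarrow> real) \<Rightarrow> nat \<Rightarrow> tree pmf" where
  "wrt w 0 = return_pmf {}"
| "wrt w (Suc 0) = return_pmf {}"
| "wrt w (Suc (Suc m)) =
     bind_pmf (wrt w (Suc m)) (\<lambda>t.
       bind_pmf (attachment w (Suc m)) (\<lambda>i.
         return_pmf (insert (i, Suc (Suc m)) t)))"

lemma pmf_attachment:
  assumes pos: "\<And>i. i \<ge> 1 \<Longrightarrow> w i > 0" and m: "m \<ge> 1"
  shows "pmf (attachment w m) i = (if i \<in> {1..m} then w i / (\<Sum>k=1..m. w k) else 0)"
proof -
  let ?f = "\<lambda>i. if i \<in> {1..m} then w i / (\<Sum>k=1..m. w k) else 0"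
  have S: "(\<Sum>k=1..m. w k) > 0"
    using pos m by (intro sum_pos) auto
  have nonneg: "0 \<le> ?f i" for i
    using pos[of i] S by (auto intro!: divide_nonneg_pos less_imp_le)
  have "(\<integral>\<^sup>+ i. ennreal (?f i) \<partial>count_space UNIV) = (\<Sum>i=1..m. ennreal (?f i))"
    by (rule nn_integral_count_space') auto
  also have "\<dots> = ennreal (\<Sum>i=1..m. ?f i)"
    using nonneg by (intro sum_ennreal)
  also have "(\<Sum>i=1..m. ?f i) = (\<Sum>i=1..m. w i / (\<Sum>k=1..m. w k))"
    by (rule sum.cong) auto
  also have "\<dots> = 1"
    using S by (simp flip: sum_divide_distrib)
  finally have one: "(\<integral>\<^sup>+ i. ennreal (?f i) \<partial>count_space UNIV) = 1"
    by simp
  show ?thesis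
    unfolding attachment_def by (rule pmf_embed_pmf[OF nonneg one])
qed

definition mean_branches :: "(nat \<Rightarrow> real) \<Rightarrow> nat \<Rightarrow> real" where
  "mean_branches w n = measure_pmf.expectation (wrt w n) (\<lambda>t. real (branches t))"

definition var_branches :: "(nat \<Rightarrow> real) \<Rightarrow> nat \<Rightarrow> real" where
  "var_branches w n = measure_pmf.variance (wrt w n) (\<lambda>t. real (branches t))"

definition standardized_branches_law :: "(nat \<Rightarrow> real) \<Rightarrow> nat \<Rightarrow> real measure" where
  "standardized_branches_law w n =
     distr (measure_pmf (wrt w n)) borel
       (\<lambda>t. (real (branches t) - mean_branches w n) / sqrt (var_branches w n))"

text \<open>
  Wasserstein distance of two probability laws on the reals with finite first moment, so that
  every Lipschitz function is integrable. The supremum is taken in the extended nonnegative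
  reals, where it exists unconditionally.
\<close>

definition wasserstein_dist :: "real measure \<Rightarrow> real measure \<Rightarrow> ennreal" where
  "wasserstein_dist M N =
     (SUP h \<in> {h :: real \<Rightarrow> real. 1-lipschitz_on UNIV h}.
        ennreal \<bar>(\<integral>x. h x \<partial>M) - (\<integral>x. h x \<partial>N)\<bar>)"

end

theory Submission
  imports Defs "HOL-Real_Asymp.Real_Asymp"
begin

text \<open>
  The number of branches of a tree of size \<open>n\<close> is a sum of independent Bernoulli variables, the
  \<open>i\<close>-th of which (\<open>1 \<le> i < n\<close>, with parameter \<open>w 1 / (w 1 + \<dots> + w i)\<close>) records whether node
  \<open>i + 1\<close> is a child of the root. The normal approximation is Stein's method. For \<open>h\<close> with
  \<open>\<bar>h'\<bar> \<le> 1\<close>, the solution \<open>f\<close> of \<open>f' x - x f x = h x - E h(G)\<close> satisfies \<open>\<bar>f x\<bar> \<le> 1\<close> and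
  \<open>\<bar>x f' x\<bar> \<le> 2\<close>, hence \<open>\<bar>f''\<bar> = \<bar>f + x f' + h'\<bar> \<le> 4\<close>. Removing one Bernoulli variable at a time
  and expanding \<open>f\<close> to second order bounds \<open>E (f' - x f)\<close> at the standardized sum by
  \<open>2 / \<sigma>\<close>; a general Lipschitz \<open>h\<close> is approximated by its moving averages. If the mean diverges,
  then so does the variance, because the parameters from the second one on stay below a constant
  less than one.
\<close>

section \<open>Stein's equation for the standard normal law\<close>

lemma has_real_derivative_std_normal_density:
  "(std_normal_density has_real_derivative - x * std_normal_density x) (at x)"
  unfolding std_normal_density_def
  by (auto intro!: derivative_eq_intros simp: field_simps)

lemma std_normal_density_tendsto_0:
  "(std_normal_density \<longlongrightarrow> 0) at_top" "(std_normal_density \<longlongrightarrow> 0) at_bot"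
  "((\<lambda>x. x * std_normal_density x) \<longlongrightarrow> 0) at_top" "((\<lambda>x. x * std_normal_density x) \<longlongrightarrow> 0) at_bot"
  unfolding std_normal_density_def by real_asymp+

lemma integrable_std_normal_mult_linear_growth:
  fixes h :: "real \<Rightarrow> real"
  assumes [measurable]: "h \<in> borel_measurable borel" and bound: "\<And>x. \<bar>h x\<bar> \<le> a + \<bar>x\<bar>"
  shows "integrable lborel (\<lambda>x. h x * std_normal_density x)"
proof (rule Bochner_Integration.integrable_bound)
  show "integrable lborel (\<lambda>x. a * std_normal_density x + std_normal_density x * \<bar>x\<bar> ^ 1)"
    by (intro Bochner_Integration.integrable_add integrable_mult_right integrable_std_normal_moment_abs
        integrable_normal_density)  simp
  show "AE x in lborel. norm (h x * std_normal_density x)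
      \<le> norm (a * std_normal_density x + std_normal_density x * \<bar>x\<bar> ^ 1)"
  proof (intro always_eventually allI)
    fix x :: real
    have "\<bar>h x\<bar> * std_normal_density x \<le> (a + \<bar>x\<bar>) * std_normal_density x"
      by (intro mult_right_mono bound) simp
    moreover have "0 \<le> a + \<bar>x\<bar>" using bound[of x] by linarith
    ultimately show "norm (h x * std_normal_density x)
      \<le> norm (a * std_normal_density x + std_normal_density x * \<bar>x\<bar> ^ 1)"
      by (simp add: abs_mult algebra_simps)
  qed
qed simp

lemma lipschitz_one_linear_growth:
  fixes h :: "real \<Rightarrow> real"
  assumes "1-lipschitz_on UNIV h"
  shows "\<bar>h x\<bar> \<le> \<bar>h 0\<bar> + \<bar>x\<bar>"
  using lipschitz_onD[OF assms, of x 0] by (simp add: dist_real_def)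

lemma lipschitz_measurable:
  fixes h :: "real \<Rightarrow> real"
  assumes "L-lipschitz_on UNIV h"
  shows "h \<in> borel_measurable borel"
  by (intro borel_measurable_continuous_onI lipschitz_on_continuous_on[OF assms])

lemma integral_std_normal:
  fixes h :: "real \<Rightarrow> real"
  assumes "h \<in> borel_measurable borel"
  shows "integral\<^sup>L std_normal_distribution h = (LINT x|lborel. h x * std_normal_density x)"
  using assms by (subst integral_density) (auto simp: mult.commute)

lemma integrable_std_normal_lipschitz:
  assumes "1-lipschitz_on UNIV (h :: real \<Rightarrow> real)"
  shows "integrable std_normal_distribution h"
  using integrable_std_normal_mult_linear_growth[OF lipschitz_measurable[OF assms] lipschitz_one_linear_growth[OF assms]]
    lipschitz_measurable[OF assms]
  by (subst integrable_density) (auto simp: mult.commute)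

text \<open>Integrability gives any primitive finite limits at both ends, and a zero total integral
  makes these limits equal, so one additive constant removes both. Applied to
  \<open>(h x - c) * std_normal_density x\<close>, this yields the numerator of the solution of
  Stein's equation.\<close>

lemma vanishing_primitive:
  fixes g :: "real \<Rightarrow> real"
  assumes cont: "\<And>x. isCont g x" and int: "integrable lborel g" and zero: "integral\<^sup>L lborel g = 0"
  obtains G where "\<And>x. (G has_real_derivative g x) (at x)" "(G \<longlongrightarrow> 0) at_top" "(G \<longlongrightarrow> 0) at_bot"
proof -
  obtain F where F: "\<And>x. (F has_real_derivative g x) (at x)"
    using einterval_antiderivative[of "-\<infinity>" "\<infinity>" g] cont
    by (auto simp: has_real_derivative_iff_has_vector_derivative)
  have [measurable]: "g \<in> borel_measurable lborel" using int by auto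
  define P N where "P = (LINT x|lborel. g x * indicator {0..} x)"
    and "N = (LINT x|lborel. g x * indicator {..0} x)"
  have intP: "integrable lborel (\<lambda>x. g x * indicator A x)" if "A \<in> sets borel" for A
    using that by (intro integrable_real_mult_indicator int) auto
  have "P + N = (LINT x|lborel. g x * indicator {0..} x + g x * indicator {..0} x)"
    unfolding P_def N_def by (subst Bochner_Integration.integral_add) (auto intro: intP)
  \<comment> \<open>The two half-lines overlap only in the point 0, a null set.\<close>
  also have "\<dots> = (LINT x|lborel. g x)"
    using AE_lborel_singleton[of "0::real"]
    by (intro integral_cong_AE) (auto elim!: eventually_mono split: split_indicator)
  finally have PN: "P + N = 0" using zero by simp
  have P: "((\<lambda>b. LINT x|lborel. g x * indicator {0..b} x) \<longlongrightarrow> P) at_top"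
    unfolding P_def
  proof (rule integral_dominated_convergence_at_top)
    show "integrable lborel (\<lambda>x. \<bar>g x\<bar>)" using int by simp
    show "\<forall>\<^sub>F b in at_top. AE x in lborel. norm (g x * indicator {0..b} x) \<le> \<bar>g x\<bar>"
      by (auto intro!: always_eventually split: split_indicator)
    show "AE x in lborel. ((\<lambda>b. g x * indicator {0..b} x) \<longlongrightarrow> g x * indicator {0..} x) at_top"
    proof (rule AE_I2, rule tendsto_mult[OF tendsto_const tendsto_eventually])
      show "\<forall>\<^sub>F b in at_top. (indicator {0..b} x :: real) = indicator {0..} x" for x :: real
        using eventually_ge_at_top[of x] by eventually_elim (auto split: split_indicator)
    qed
  qed auto
  have N: "((\<lambda>b. LINT x|lborel. g x * indicator {-b..0} x) \<longlongrightarrow> N) at_top"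
    unfolding N_def
  proof (rule integral_dominated_convergence_at_top)
    show "integrable lborel (\<lambda>x. \<bar>g x\<bar>)" using int by simp
    show "\<forall>\<^sub>F b in at_top. AE x in lborel. norm (g x * indicator {-b..0} x) \<le> \<bar>g x\<bar>"
      by (auto intro!: always_eventually split: split_indicator)
    show "AE x in lborel. ((\<lambda>b. g x * indicator {-b..0} x) \<longlongrightarrow> g x * indicator {..0} x) at_top"
    proof (rule AE_I2, rule tendsto_mult[OF tendsto_const tendsto_eventually])
      show "\<forall>\<^sub>F b in at_top. (indicator {-b..0} x :: real) = indicator {..0} x" for x :: real
        using eventually_ge_at_top[of "-x"] by eventually_elim (auto split: split_indicator)
    qed
  qed auto
  have FTC: "(LINT x|lborel. g x * indicator {a..b} x) = F b - F a" if "a \<le> b" for a b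
    by (rule integral_FTC_Icc_real[OF that F cont])
  have top: "(F \<longlongrightarrow> F 0 + P) at_top"
  proof -
    have "((\<lambda>b. F 0 + (LINT x|lborel. g x * indicator {0..b} x)) \<longlongrightarrow> F 0 + P) at_top"
      by (intro tendsto_add tendsto_const P)
    moreover have "\<forall>\<^sub>F b in at_top. F 0 + (LINT x|lborel. g x * indicator {0..b} x) = F b"
      using eventually_ge_at_top[of 0] by eventually_elim (simp add: FTC)
    ultimately show ?thesis by (rule Lim_transform_eventually)
  qed
  have bot: "(F \<longlongrightarrow> F 0 - N) at_bot"
  proof -
    have "((\<lambda>b. F 0 - (LINT x|lborel. g x * indicator {-b..0} x)) \<longlongrightarrow> F 0 - N) at_top"
      by (intro tendsto_diff tendsto_const N)
    moreover have "\<forall>\<^sub>F b in at_top. F 0 - (LINT x|lborel. g x * indicator {-b..0} x) = F (-b)"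
      using eventually_ge_at_top[of 0] by eventually_elim (simp add: FTC)
    ultimately show ?thesis
      unfolding filterlim_at_bot_mirror by (rule Lim_transform_eventually)
  qed
  have bot_eq: "F 0 - N - (F 0 + P) = 0" using PN by simp
  show thesis
  proof (rule that[of "\<lambda>x. F x - (F 0 + P)"])
    show "((\<lambda>x. F x - (F 0 + P)) has_real_derivative g x) (at x)" for x
      by (auto intro!: derivative_eq_intros F)
    show "((\<lambda>x. F x - (F 0 + P)) \<longlongrightarrow> 0) at_top"
      using tendsto_diff[OF top tendsto_const[of "F 0 + P"]] by simp
    show "((\<lambda>x. F x - (F 0 + P)) \<longlongrightarrow> 0) at_bot"
      using tendsto_diff[OF bot tendsto_const[of "F 0 + P"]] unfolding bot_eq .
  qed
qed

section \<open>Pointwise bounds from derivative signs and limits at infinity\<close>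

lemma nonincreasing_tendsto_0_imp_nonneg:
  fixes U U' :: "real \<Rightarrow> real"
  assumes "\<And>y. x \<le> y \<Longrightarrow> (U has_real_derivative U' y) (at y)" "\<And>y. x \<le> y \<Longrightarrow> U' y \<le> 0"
    and "(U \<longlongrightarrow> 0) at_top"
  shows "0 \<le> U x"
proof (rule tendsto_upperbound[OF assms(3)])
  show "\<forall>\<^sub>F y in at_top. U y \<le> U x"
    using eventually_ge_at_top[of x]
  proof eventually_elim
    case (elim y)
    then show ?case
      by (rule DERIV_nonpos_imp_nonincreasing) (use assms in blast)
  qed
qed simp

lemma nondecreasing_tendsto_0_imp_nonneg:
  fixes U U' :: "real \<Rightarrow> real"
  assumes "\<And>y. y \<le> x \<Longrightarrow> (U has_real_derivative U' y) (at y)" "\<And>y. y \<le> x \<Longrightarrow> U' y \<ge> 0"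
    and "(U \<longlongrightarrow> 0) at_bot"
  shows "0 \<le> U x"
proof (rule tendsto_upperbound[OF assms(3)])
  show "\<forall>\<^sub>F y in at_bot. U y \<le> U x"
    using eventually_le_at_bot[of x]
  proof eventually_elim
    case (elim y)
    then show ?case
      by (rule DERIV_nonneg_imp_nondecreasing) (use assms in blast)
  qed
qed simp

text \<open>\<open>U\<close> first increases and then decreases, because its derivative has the sign of \<open>k\<close>.\<close>

lemma unimodal_tendsto_0_imp_nonneg:
  fixes U k \<phi> :: "real \<Rightarrow> real"
  assumes deriv: "\<And>y. (U has_real_derivative k y * \<phi> y) (at y)"
    and "antimono k" and pos: "\<And>y. \<phi> y \<ge> 0"
    and "(U \<longlongrightarrow> 0) at_top" "(U \<longlongrightarrow> 0) at_bot"
  shows "0 \<le> U x"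
proof (cases "k x \<ge> 0")
  case True
  then have "k y \<ge> 0" if "y \<le> x" for y
    using antimonoD[OF \<open>antimono k\<close> that] by simp
  then show ?thesis
    using assms by (intro nondecreasing_tendsto_0_imp_nonneg[OF deriv]) auto
next
  case False
  then have "k y \<le> 0" if "x \<le> y" for y
    using antimonoD[OF \<open>antimono k\<close> that] by simp
  then show ?thesis
    using assms by (intro nonincreasing_tendsto_0_imp_nonneg[OF deriv]) (auto intro: mult_nonpos_nonneg)
qed

text \<open>The Mills ratio bound: on \<open>{0<..}\<close> the derivative of \<open>\<phi> y / y\<close> is at most \<open>- \<phi> y\<close>.\<close>

lemma std_normal_tail_bound_pos:
  fixes V k :: "real \<Rightarrow> real"
  assumes deriv: "\<And>y. (V has_real_derivative k y * std_normal_density y) (at y)"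
    and k: "\<And>y. \<bar>k y\<bar> \<le> C" and lim: "(V \<longlongrightarrow> 0) at_top" and x: "x > 0"
  shows "x * V x \<le> C * std_normal_density x"
proof -
  let ?\<phi> = std_normal_density
  have C: "0 \<le> C" using k[of 0] by linarith
  have "0 \<le> C * ?\<phi> x / x - V x"
  proof (rule nonincreasing_tendsto_0_imp_nonneg[where U="\<lambda>y. C * ?\<phi> y / y - V y"
        and U'="\<lambda>y. - C * ?\<phi> y - C * ?\<phi> y / y\<^sup>2 - k y * ?\<phi> y"])
    fix y assume "x \<le> y"
    with x have y: "y > 0" by simp
    show "((\<lambda>y. C * ?\<phi> y / y - V y) has_real_derivative - C * ?\<phi> y - C * ?\<phi> y / y\<^sup>2 - k y * ?\<phi> y) (at y)"
      using y by (auto intro!: derivative_eq_intros has_real_derivative_std_normal_density deriv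
          simp: field_simps power2_eq_square)
    have "- k y * ?\<phi> y \<le> C * ?\<phi> y"
      using k[of y] by (intro mult_right_mono) auto
    moreover have "0 \<le> C * ?\<phi> y / y\<^sup>2" using C by simp
    ultimately show "- C * ?\<phi> y - C * ?\<phi> y / y\<^sup>2 - k y * ?\<phi> y \<le> 0" by simp
  next
    have "((\<lambda>y. C * ?\<phi> y * inverse y) \<longlongrightarrow> C * 0 * 0) at_top"
      by (intro tendsto_mult tendsto_const std_normal_density_tendsto_0 tendsto_inverse_0_at_top filterlim_ident)
    from tendsto_diff[OF this lim] show "((\<lambda>y. C * ?\<phi> y / y - V y) \<longlongrightarrow> 0) at_top"
      by (simp add: divide_inverse)
  qed
  with x show ?thesis by (simp add: field_simps)
qed

text \<open>The one-sided estimate, applied to \<open>V\<close> and to \<open>- V\<close>, gives the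
  absolute value for positive \<open>x\<close>; negative \<open>x\<close> is reached by reflection,
  since the density is even.\<close>

lemma std_normal_tail_bound:
  fixes V k :: "real \<Rightarrow> real"
  assumes deriv: "\<And>y. (V has_real_derivative k y * std_normal_density y) (at y)"
    and k: "\<And>y. \<bar>k y\<bar> \<le> C" and lim: "(V \<longlongrightarrow> 0) at_top" "(V \<longlongrightarrow> 0) at_bot"
  shows "\<bar>x * V x\<bar> \<le> C * std_normal_density x"
proof -
  have pos: "\<bar>x * V x\<bar> \<le> C * std_normal_density x"
    if "\<And>y. (V has_real_derivative k y * std_normal_density y) (at y)" "\<And>y. \<bar>k y\<bar> \<le> C"
      "(V \<longlongrightarrow> 0) at_top" "x > 0" for V k :: "real \<Rightarrow> real" and x
  proof -
    have "((\<lambda>y. - V y) has_real_derivative (- k y) * std_normal_density y) (at y)" for y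
      using DERIV_minus[OF that(1)] by simp
    moreover have "((\<lambda>y. - V y) \<longlongrightarrow> 0) at_top" using tendsto_minus[OF that(3)] by simp
    ultimately have "x * (- V x) \<le> C * std_normal_density x"
      using that(2,4) by (intro std_normal_tail_bound_pos[where k="\<lambda>y. - k y"]) auto
    with std_normal_tail_bound_pos[OF that] show ?thesis by simp
  qed
  consider "x > 0" | "x = 0" | "x < 0" by linarith
  then show ?thesis
  proof cases
    case 1
    then show ?thesis using pos assms by blast
  next
    case 2
    then show ?thesis using k[of 0] by simp
  next
    case 3
    have "((\<lambda>y. V (- y)) has_real_derivative (- k (- y)) * std_normal_density y) (at y)" for y
    proof -
      have "((\<lambda>y. V (- y)) has_real_derivative (k (- y) * std_normal_density (- y)) * (- 1)) (at y)"
        by (rule DERIV_chain2[OF deriv]) (auto intro!: derivative_eq_intros)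
      then show ?thesis by (simp add: std_normal_density_def)
    qed
    moreover have "((\<lambda>y. V (- y)) \<longlongrightarrow> 0) at_top"
      using lim(2) by (simp add: filterlim_at_bot_mirror)
    ultimately have "\<bar>(- x) * V (- (- x))\<bar> \<le> C * std_normal_density (- x)"
      using k 3 by (intro pos[where k="\<lambda>y. - k (- y)" and V="\<lambda>y. V (- y)"]) auto
    then show ?thesis by (simp add: std_normal_density_def)
  qed
qed

section \<open>The solution of Stein's equation and its derivatives\<close>

lemma lipschitz_one_derivative:
  fixes h h' :: "real \<Rightarrow> real"
  assumes "\<And>x. (h has_real_derivative h' x) (at x)" "\<And>x. \<bar>h' x\<bar> \<le> 1"
  shows "1-lipschitz_on UNIV h"
proof (rule lipschitz_onI)
  show "dist (h x) (h y) \<le> 1 * dist x y" for x y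
    using field_differentiable_bound[of UNIV h h' 1 x y] assms by (simp add: dist_norm)
qed simp

text \<open>Variation of constants: writing \<open>f\<close> as \<open>G\<close> divided by the
  density turns the equation into one that prescribes the derivative of \<open>G\<close>. Choosing
  the primitive that vanishes at both ends is what keeps \<open>f\<close> bounded. The estimates
  then compare \<open>G\<close>, and later \<open>f'\<close> times the density, with the density
  itself.\<close>

lemma stein_equation_solution:
  fixes h h' :: "real \<Rightarrow> real"
  assumes deriv: "\<And>x. (h has_real_derivative h' x) (at x)" and h': "\<And>x. \<bar>h' x\<bar> \<le> 1"
  obtains f f' f'' :: "real \<Rightarrow> real" where
    "\<And>x. (f has_real_derivative f' x) (at x)" "\<And>x. (f' has_real_derivative f'' x) (at x)"
    "\<And>x. \<bar>f'' x\<bar> \<le> 4" "\<And>x. f' x - x * f x = h x - integral\<^sup>L std_normal_distribution h"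
proof -
  let ?\<phi> = std_normal_density
  note D\<phi> = has_real_derivative_std_normal_density
  define c where "c = integral\<^sup>L std_normal_distribution h"
  have lip: "1-lipschitz_on UNIV h" by (rule lipschitz_one_derivative[OF deriv h'])
  have [measurable]: "h \<in> borel_measurable borel" by (rule lipschitz_measurable[OF lip])
  have int_h: "integrable lborel (\<lambda>x. h x * ?\<phi> x)"
    by (rule integrable_std_normal_mult_linear_growth) (auto intro: lipschitz_one_linear_growth[OF lip])
  \<comment> \<open>Since \<open>c\<close> is the Gaussian mean of \<open>h\<close>, the integrand
    has total integral zero.\<close>
  obtain G where G: "\<And>x. (G has_real_derivative (h x - c) * ?\<phi> x) (at x)"
    and Glim: "(G \<longlongrightarrow> 0) at_top" "(G \<longlongrightarrow> 0) at_bot"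
  proof (rule vanishing_primitive[of "\<lambda>x. (h x - c) * ?\<phi> x"])
    show "isCont (\<lambda>x. (h x - c) * ?\<phi> x) x" for x
      using DERIV_isCont[OF deriv] DERIV_isCont[OF D\<phi>] by (intro continuous_intros) auto
    show "integrable lborel (\<lambda>x. (h x - c) * ?\<phi> x)"
      using int_h by (simp add: left_diff_distrib)
    show "(LINT x|lborel. (h x - c) * ?\<phi> x) = 0"
      using int_h by (simp add: left_diff_distrib integral_std_normal c_def)
  qed blast
  define f where "f x = G x / ?\<phi> x" for x
  define f' where "f' x = x * f x + (h x - c)" for x
  define f'' where "f'' x = f x + x * f' x + h' x" for x
  have \<phi>0: "?\<phi> x > 0" for x by (simp add: normal_density_pos)
  have f: "(f has_real_derivative f' x) (at x)" for x
    unfolding f_def[abs_def] f'_def using \<phi>0[of x]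
    by (auto intro!: derivative_eq_intros G D\<phi> simp: field_simps)
  have f'_deriv: "(f' has_real_derivative f'' x) (at x)" for x
    unfolding f'_def[abs_def] f''_def
    by (auto intro!: derivative_eq_intros f deriv simp: f'_def)
  have hdiff: "\<bar>h y - h x\<bar> \<le> \<bar>y - x\<bar>" for x y
    using lipschitz_onD[OF lip, of y x] by (simp add: dist_real_def)
  \<comment> \<open>The derivative of \<open>?\<phi> x + s * G x\<close> carries the factor
    \<open>s * (h y - c) - y\<close>, which is nonincreasing because \<open>h\<close> is
    1-Lipschitz. The signs \<open>s = 1\<close> and \<open>s = -1\<close> together bound
    \<open>\<bar>G x\<bar>\<close> by the density, hence \<open>\<bar>f x\<bar>\<close> by
    1.\<close>
  have G_le: "0 \<le> ?\<phi> x + s * G x" if "\<bar>s\<bar> = 1" for s x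
  proof (rule unimodal_tendsto_0_imp_nonneg[where k="\<lambda>y. s * (h y - c) - y" and \<phi>="?\<phi>"
        and U="\<lambda>x. ?\<phi> x + s * G x"])
    show "((\<lambda>x. ?\<phi> x + s * G x) has_real_derivative (s * (h y - c) - y) * ?\<phi> y) (at y)" for y
      by (auto intro!: derivative_eq_intros G D\<phi> simp: algebra_simps)
    show "antimono (\<lambda>y. s * (h y - c) - y)"
    proof (rule antimonoI)
      fix x y :: real assume "x \<le> y"
      have "s * (h y - h x) \<le> \<bar>h y - h x\<bar>" using abs_ge_self[of "s * (h y - h x)"] that by (simp add: abs_mult)
      with hdiff[of y x] \<open>x \<le> y\<close> show "s * (h y - c) - y \<le> s * (h x - c) - x"
        by (simp add: algebra_simps)
    qed
    show "((\<lambda>x. ?\<phi> x + s * G x) \<longlongrightarrow> 0) at_top"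
      using tendsto_add[OF std_normal_density_tendsto_0(1) tendsto_mult[OF tendsto_const[of s] Glim(1)]] by simp
    show "((\<lambda>x. ?\<phi> x + s * G x) \<longlongrightarrow> 0) at_bot"
      using tendsto_add[OF std_normal_density_tendsto_0(2) tendsto_mult[OF tendsto_const[of s] Glim(2)]] by simp
  qed simp
  have G_abs: "\<bar>G x\<bar> \<le> ?\<phi> x" for x using G_le[of 1 x] G_le[of "-1" x] by simp
  have f_le: "\<bar>f x\<bar> \<le> 1" for x using G_abs[of x] \<phi>0[of x] by (simp add: f_def)
  \<comment> \<open>In the derivative of \<open>V\<close> the term \<open>x * f' x\<close> of
    \<open>f''\<close> cancels against the derivative of the density, leaving \<open>f + h'\<close>
    times the density. This factor is at most 2 in absolute value, so the tail bound controls
    \<open>x * f' x\<close>.\<close>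
  define V where "V x = f' x * ?\<phi> x" for x
  have V_eq: "V x = x * G x + (h x - c) * ?\<phi> x" for x
    using \<phi>0[of x] by (simp add: V_def f'_def f_def field_simps)
  \<comment> \<open>This domination shows that \<open>V\<close> vanishes at both ends, as the tail
    bound requires.\<close>
  have V_le: "norm (V x) \<le> (\<bar>h 0\<bar> + \<bar>c\<bar>) * ?\<phi> x + 2 * norm (x * ?\<phi> x)" for x
  proof -
    have "\<bar>V x\<bar> \<le> \<bar>x\<bar> * \<bar>G x\<bar> + \<bar>h x - c\<bar> * ?\<phi> x"
      unfolding V_eq by (rule order_trans[OF abs_triangle_ineq]) (simp add: abs_mult)
    also have "\<dots> \<le> \<bar>x\<bar> * ?\<phi> x + (\<bar>h 0\<bar> + \<bar>c\<bar> + \<bar>x\<bar>) * ?\<phi> x"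
      using G_abs[of x] hdiff[of x 0]
      by (intro add_mono mult_left_mono mult_right_mono) auto
    finally show ?thesis by (simp add: algebra_simps abs_mult)
  qed
  have V_lim: "(V \<longlongrightarrow> 0) F" if "(?\<phi> \<longlongrightarrow> 0) F" "((\<lambda>x. x * ?\<phi> x) \<longlongrightarrow> 0) F" for F
  proof (rule Lim_null_comparison)
    show "\<forall>\<^sub>F x in F. norm (V x) \<le> (\<bar>h 0\<bar> + \<bar>c\<bar>) * ?\<phi> x + 2 * norm (x * ?\<phi> x)"
      using V_le by simp
    show "((\<lambda>x. (\<bar>h 0\<bar> + \<bar>c\<bar>) * ?\<phi> x + 2 * norm (x * ?\<phi> x)) \<longlongrightarrow> 0) F"
      using tendsto_add[OF tendsto_mult[OF tendsto_const that(1)] tendsto_mult[OF tendsto_const tendsto_norm[OF that(2)]],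
          of "\<bar>h 0\<bar> + \<bar>c\<bar>" 2] by simp
  qed
  have "\<bar>x * V x\<bar> \<le> 2 * ?\<phi> x" for x
  proof (rule std_normal_tail_bound)
    show "(V has_real_derivative (f y + h' y) * ?\<phi> y) (at y)" for y
      unfolding V_def[abs_def]
      by (auto intro!: derivative_eq_intros f'_deriv D\<phi> simp: f''_def algebra_simps)
    show "\<bar>f y + h' y\<bar> \<le> 2" for y using f_le[of y] h'[of y] by linarith
  qed (intro V_lim std_normal_density_tendsto_0)+
  then have "\<bar>x * f' x\<bar> * ?\<phi> x \<le> 2 * ?\<phi> x" for x
    by (simp add: V_def abs_mult mult.assoc)
  then have xf': "\<bar>x * f' x\<bar> \<le> 2" for x
    using \<phi>0[of x] by (rule mult_right_le_imp_le)
  have "\<bar>f'' x\<bar> \<le> 4" for x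
    using f_le[of x] xf'[of x] h'[of x] unfolding f''_def by linarith
  with f f'_deriv show thesis
    by (rule that) (simp add: f'_def c_def)
qed

section \<open>Normal approximation of sums of independent Bernoulli variables\<close>

text \<open>The trials are indexed by an arbitrary set so that single ones can be removed: Stein's
  argument compares the law on \<open>A\<close> with the laws on \<open>A - {i}\<close>.\<close>

definition poisson_binomial :: "'a set \<Rightarrow> ('a \<Rightarrow> real) \<Rightarrow> nat pmf" where
  "poisson_binomial A p =
     map_pmf (\<lambda>b. \<Sum>i\<in>A. of_bool (b i)) (Pi_pmf A False (\<lambda>i. bernoulli_pmf (p i)))"

lemma poisson_binomial_empty: "poisson_binomial {} p = return_pmf 0"
  by (simp add: poisson_binomial_def)

lemma poisson_binomial_insert:
  assumes "finite A" "x \<notin> A"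
  shows "poisson_binomial (insert x A) p =
    bind_pmf (bernoulli_pmf (p x)) (\<lambda>c. map_pmf (\<lambda>k. of_bool c + k) (poisson_binomial A p))"
proof -
  have "(\<Sum>i\<in>A. of_bool ((f(x := y)) i)) = (\<Sum>i\<in>A. of_bool (f i) :: nat)" for f y
    using assms by (intro sum.cong) auto
  with assms show ?thesis
    by (simp add: poisson_binomial_def Pi_pmf_insert' map_pmf_def bind_assoc_pmf bind_return_pmf
        del: sum_of_bool_eq)
qed

lemma finite_set_pmf_poisson_binomial [simp]:
  "finite A \<Longrightarrow> finite (set_pmf (poisson_binomial A p))"
  by (induction A rule: finite_induct) (auto simp: poisson_binomial_empty poisson_binomial_insert)

lemma integrable_poisson_binomial [simp]:
  "finite A \<Longrightarrow> integrable (measure_pmf (poisson_binomial A p)) (g :: nat \<Rightarrow> real)"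
  by (intro integrable_measure_pmf_finite finite_set_pmf_poisson_binomial)

lemma expectation_poisson_binomial_insert:
  fixes g :: "nat \<Rightarrow> real"
  assumes "finite A" "x \<notin> A" "0 \<le> p x" "p x \<le> 1"
  shows "measure_pmf.expectation (poisson_binomial (insert x A) p) g =
    p x * measure_pmf.expectation (poisson_binomial A p) (\<lambda>k. g (Suc k)) +
    (1 - p x) * measure_pmf.expectation (poisson_binomial A p) g"
  using assms
  unfolding poisson_binomial_insert[OF assms(1,2)]
  by (subst pmf_expectation_bind[where A=UNIV]) (auto simp: UNIV_bool)

lemma expectation_poisson_binomial_remove:
  fixes g :: "nat \<Rightarrow> real"
  assumes "finite A" "i \<in> A" "0 \<le> p i" "p i \<le> 1"
  shows "measure_pmf.expectation (poisson_binomial A p) g =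
    p i * measure_pmf.expectation (poisson_binomial (A - {i}) p) (\<lambda>k. g (Suc k)) +
    (1 - p i) * measure_pmf.expectation (poisson_binomial (A - {i}) p) g"
  using assms expectation_poisson_binomial_insert[of "A - {i}" i p g]
  by (simp add: insert_absorb)

lemma mean_poisson_binomial:
  assumes "finite A" "\<And>i. i \<in> A \<Longrightarrow> 0 \<le> p i \<and> p i \<le> 1"
  shows "measure_pmf.expectation (poisson_binomial A p) real = (\<Sum>i\<in>A. p i)"
  using assms
proof (induction A rule: finite_induct)
  case (insert x A)
  then show ?case
    by (simp add: expectation_poisson_binomial_insert of_nat_Suc algebra_simps)
qed (simp add: poisson_binomial_empty)

text \<open>For independent trials \<open>X i\<close> with sum \<open>W\<close>, conditioning on
  \<open>X i\<close> turns the expectation of \<open>(X i - p i) * g W\<close> into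
  \<open>p i * (1 - p i)\<close> times the expected increment of \<open>g\<close> at
  \<open>W - X i\<close>; summing over \<open>i\<close> gives the identity. The induction carries
  this out on laws, conditioning on the inserted trial.\<close>

lemma poisson_binomial_stein_identity:
  fixes g :: "nat \<Rightarrow> real"
  assumes "finite A" "\<And>i. i \<in> A \<Longrightarrow> 0 \<le> p i \<and> p i \<le> 1"
  shows "measure_pmf.expectation (poisson_binomial A p) (\<lambda>k. (real k - (\<Sum>i\<in>A. p i)) * g k) =
    (\<Sum>i\<in>A. p i * (1 - p i) *
      (measure_pmf.expectation (poisson_binomial (A - {i}) p) (\<lambda>k. g (Suc k)) -
       measure_pmf.expectation (poisson_binomial (A - {i}) p) g))"
  using assms
proof (induction A arbitrary: g rule: finite_induct)
  case empty
  then show ?case by (simp add: poisson_binomial_empty)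
next
  case (insert x A)
  let ?E = "\<lambda>B. measure_pmf.expectation (poisson_binomial B p)"
  let ?D = "\<lambda>B g. ?E B (\<lambda>k. g (Suc k)) - ?E B g"
  let ?m = "\<Sum>i\<in>A. p i"
  have px: "0 \<le> p x" "p x \<le> 1" using insert.prems by auto
  have "?E (insert x A) (\<lambda>k. (real k - (\<Sum>i\<in>insert x A. p i)) * g k) =
    p x * ?E A (\<lambda>k. (real (Suc k) - (p x + ?m)) * g (Suc k)) +
    (1 - p x) * ?E A (\<lambda>k. (real k - (p x + ?m)) * g k)"
    using insert.hyps px by (simp add: expectation_poisson_binomial_insert)
  also have "(\<lambda>k. (real (Suc k) - (p x + ?m)) * g (Suc k)) =
    (\<lambda>k. (real k - ?m) * g (Suc k) + (1 - p x) * g (Suc k))"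
    by (simp add: algebra_simps)
  also have "(\<lambda>k. (real k - (p x + ?m)) * g k) = (\<lambda>k. (real k - ?m) * g k - p x * g k)"
    by (simp add: algebra_simps)
  \<comment> \<open>Recentring leaves a remainder with factor \<open>p x * (1 - p x)\<close>, which
    is the summand of the new trial. The other two terms are instances of the induction hypothesis,
    for the shifted \<open>g\<close> and for \<open>g\<close>.\<close>
  also have "p x * ?E A (\<lambda>k. (real k - ?m) * g (Suc k) + (1 - p x) * g (Suc k)) +
      (1 - p x) * ?E A (\<lambda>k. (real k - ?m) * g k - p x * g k) =
    p x * ?E A (\<lambda>k. (real k - ?m) * g (Suc k)) + (1 - p x) * ?E A (\<lambda>k. (real k - ?m) * g k) +
    p x * (1 - p x) * ?D A g"
    using insert.hyps by (simp add: algebra_simps)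
  also have "?E A (\<lambda>k. (real k - ?m) * g (Suc k)) =
      (\<Sum>i\<in>A. p i * (1 - p i) * ?D (A - {i}) (\<lambda>k. g (Suc k)))"
    using insert.prems by (intro insert.IH) auto
  also have "?E A (\<lambda>k. (real k - ?m) * g k) = (\<Sum>i\<in>A. p i * (1 - p i) * ?D (A - {i}) g)"
    using insert.prems by (intro insert.IH) auto
  \<comment> \<open>Mixing over the outcome of trial \<open>x\<close> turns the law on
    \<open>A - {i}\<close> into the law on \<open>insert x A - {i}\<close>.\<close>
  also have "p x * (\<Sum>i\<in>A. p i * (1 - p i) * ?D (A - {i}) (\<lambda>k. g (Suc k))) +
      (1 - p x) * (\<Sum>i\<in>A. p i * (1 - p i) * ?D (A - {i}) g) =
    (\<Sum>i\<in>A. p i * (1 - p i) * ?D (insert x A - {i}) g)"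
    unfolding sum_distrib_left sum.distrib[symmetric]
  proof (rule sum.cong)
    fix i assume "i \<in> A"
    with insert.hyps have "insert x A - {i} = insert x (A - {i})" by auto
    with insert.hyps px show "p x * (p i * (1 - p i) * ?D (A - {i}) (\<lambda>k. g (Suc k))) +
        (1 - p x) * (p i * (1 - p i) * ?D (A - {i}) g) = p i * (1 - p i) * ?D (insert x A - {i}) g"
      by (simp add: expectation_poisson_binomial_insert algebra_simps)
  qed simp
  finally show ?case using insert.hyps by simp
qed

text \<open>This is the Stein identity for \<open>g k = real k - (\<Sum>i\<in>A. p i)\<close>, whose
  increments are all 1.\<close>

lemma variance_poisson_binomial:
  assumes "finite A" "\<And>i. i \<in> A \<Longrightarrow> 0 \<le> p i \<and> p i \<le> 1"
  shows "measure_pmf.variance (poisson_binomial A p) real = (\<Sum>i\<in>A. p i * (1 - p i))"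
proof -
  have "measure_pmf.variance (poisson_binomial A p) real =
    measure_pmf.expectation (poisson_binomial A p)
      (\<lambda>k. (real k - (\<Sum>i\<in>A. p i)) * (real k - (\<Sum>i\<in>A. p i)))"
    using assms by (simp add: mean_poisson_binomial power2_eq_square)
  also have "\<dots> = (\<Sum>i\<in>A. p i * (1 - p i))"
    using assms by (subst poisson_binomial_stein_identity) (auto simp: of_nat_Suc)
  finally show ?thesis .
qed

section \<open>Second-order expansion and the bound for smooth test functions\<close>

lemma quadratic_remainder_bound:
  fixes f f' f'' :: "real \<Rightarrow> real"
  assumes "\<And>x. (f has_real_derivative f' x) (at x)" "\<And>x. (f' has_real_derivative f'' x) (at x)"
    and bound: "\<And>x. \<bar>f'' x\<bar> \<le> C"
  shows "\<bar>f y - f x - (y - x) * f' x\<bar> \<le> C / 2 * (y - x)\<^sup>2"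
proof (cases "y = x")
  case False
  let ?d = "\<lambda>m::nat. if m = 0 then f else if m = 1 then f' else f''"
  have "\<exists>t. (if y < x then y < t \<and> t < x else x < t \<and> t < y) \<and>
    f y = (\<Sum>m<2. ?d m x / fact m * (y - x) ^ m) + ?d 2 t / fact 2 * (y - x) ^ 2"
    by (rule Taylor[of 2 ?d f "min x y" "max x y"]) (use assms False in \<open>auto simp: less_2_cases_iff\<close>)
  then obtain t where t: "f y - f x - (y - x) * f' x = f'' t / 2 * (y - x)\<^sup>2"
    by (auto simp: numeral_2_eq_2 algebra_simps)
  have "\<bar>f'' t / 2\<bar> * (y - x)\<^sup>2 \<le> C / 2 * (y - x)\<^sup>2"
    using bound[of t] by (intro mult_right_mono) auto
  then show ?thesis unfolding t by (simp add: abs_mult)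
qed simp

text \<open>Up to sign, the difference is a convex combination, with weights \<open>p\<close> and
  \<open>1 - p\<close>, of the first-order Taylor remainders of \<open>f\<close> about
  \<open>a + \<delta>\<close> and about \<open>a\<close>.\<close>

lemma stein_bernoulli_remainder:
  fixes f f' f'' :: "real \<Rightarrow> real"
  assumes "\<And>x. (f has_real_derivative f' x) (at x)" "\<And>x. (f' has_real_derivative f'' x) (at x)"
    and "\<And>x. \<bar>f'' x\<bar> \<le> C" "0 \<le> p" "p \<le> 1"
  shows "\<bar>\<delta> * (p * f' (a + \<delta>) + (1 - p) * f' a) - (f (a + \<delta>) - f a)\<bar> \<le> C / 2 * \<delta>\<^sup>2"
proof -
  have l: "\<bar>f a - f (a + \<delta>) + \<delta> * f' (a + \<delta>)\<bar> \<le> C / 2 * \<delta>\<^sup>2"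
    using quadratic_remainder_bound[OF assms(1-3), of a "a + \<delta>"] by simp
  have r: "\<bar>f a - f (a + \<delta>) + \<delta> * f' a\<bar> \<le> C / 2 * \<delta>\<^sup>2"
    using quadratic_remainder_bound[OF assms(1-3), of "a + \<delta>" a]
    unfolding add_diff_cancel_left' by linarith
  have "\<delta> * (p * f' (a + \<delta>) + (1 - p) * f' a) - (f (a + \<delta>) - f a) =
    p * (f a - f (a + \<delta>) + \<delta> * f' (a + \<delta>)) + (1 - p) * (f a - f (a + \<delta>) + \<delta> * f' a)"
    by (simp add: algebra_simps)
  also have "\<bar>\<dots>\<bar> \<le> p * \<bar>f a - f (a + \<delta>) + \<delta> * f' (a + \<delta>)\<bar> + (1 - p) * \<bar>f a - f (a + \<delta>) + \<delta> * f' a\<bar>"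
    using assms(4,5) by (intro order_trans[OF abs_triangle_ineq]) (simp add: abs_mult)
  also have "\<dots> \<le> C / 2 * \<delta>\<^sup>2"
    using assms(4,5) by (intro convex_bound_le l r) auto
  finally show ?thesis .
qed

text \<open>Both terms of Stein's equation become sums over the trials with the same weights
  \<open>p i * (1 - p i) / \<sigma>\<close> and the same laws on \<open>A - {i}\<close>. They can
  then be subtracted trial by trial, and each difference is the remainder bounded in
  \<open>stein_bernoulli_remainder\<close>.\<close>

lemma poisson_binomial_normal_approx_smooth:
  fixes h h' :: "real \<Rightarrow> real"
  assumes A: "finite A" and p: "\<And>i. i \<in> A \<Longrightarrow> 0 \<le> p i \<and> p i \<le> 1"
    and \<sigma>: "\<sigma> > 0" "\<sigma>\<^sup>2 = (\<Sum>i\<in>A. p i * (1 - p i))"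
    and h: "\<And>x. (h has_real_derivative h' x) (at x)" "\<And>x. \<bar>h' x\<bar> \<le> 1"
  shows "\<bar>measure_pmf.expectation (poisson_binomial A p) (\<lambda>k. h ((real k - (\<Sum>i\<in>A. p i)) / \<sigma>)) -
    integral\<^sup>L std_normal_distribution h\<bar> \<le> 2 / \<sigma>"
proof -
  obtain f f' f'' :: "real \<Rightarrow> real" where
    f: "\<And>x. (f has_real_derivative f' x) (at x)" "\<And>x. (f' has_real_derivative f'' x) (at x)"
      "\<And>x. \<bar>f'' x\<bar> \<le> 4" and
    eq: "\<And>x. f' x - x * f x = h x - integral\<^sup>L std_normal_distribution h"
    using stein_equation_solution[OF h] by metis
  let ?E = "\<lambda>B. measure_pmf.expectation (poisson_binomial B p)"
  let ?m = "\<Sum>i\<in>A. p i"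
  let ?x = "\<lambda>k. (real k - ?m) / \<sigma>"
  let ?r = "\<lambda>i k. 1 / \<sigma> * (p i * f' (?x k + 1 / \<sigma>) + (1 - p i) * f' (?x k)) - (f (?x k + 1 / \<sigma>) - f (?x k))"
  have Suc_x: "?x (Suc k) = ?x k + 1 / \<sigma>" for k by (simp add: add_divide_distrib diff_divide_distrib)
  have "?E A (\<lambda>k. ?x k * f (?x k)) = ?E A (\<lambda>k. (real k - ?m) * (f (?x k) / \<sigma>))"
    by simp
  also have "\<dots> = (\<Sum>i\<in>A. p i * (1 - p i) *
      (?E (A - {i}) (\<lambda>k. f (?x (Suc k)) / \<sigma>) - ?E (A - {i}) (\<lambda>k. f (?x k) / \<sigma>)))"
    by (rule poisson_binomial_stein_identity[OF A p])
  also have "\<dots> = (\<Sum>i\<in>A. p i * (1 - p i) / \<sigma> * ?E (A - {i}) (\<lambda>k. f (?x k + 1 / \<sigma>) - f (?x k)))"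
    using A unfolding Suc_x by (intro sum.cong) (simp_all flip: diff_divide_distrib)
  finally have xf: "?E A (\<lambda>k. ?x k * f (?x k)) =
    (\<Sum>i\<in>A. p i * (1 - p i) / \<sigma> * ?E (A - {i}) (\<lambda>k. f (?x k + 1 / \<sigma>) - f (?x k)))" .
  \<comment> \<open>The factor 1 is written as a sum of variances over
    \<open>\<sigma>\<^sup>2\<close>, which spreads the expectation over the trials with the weights
    of \<open>xf\<close>.\<close>
  have "?E A (\<lambda>k. f' (?x k)) = (\<Sum>i\<in>A. p i * (1 - p i)) / \<sigma>\<^sup>2 * ?E A (\<lambda>k. f' (?x k))"
    unfolding \<sigma>(2)[symmetric] using \<sigma>(1) by simp
  also have "\<dots> = (\<Sum>i\<in>A. p i * (1 - p i) / \<sigma> * (1 / \<sigma> * ?E A (\<lambda>k. f' (?x k))))"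
    unfolding sum_divide_distrib sum_distrib_right by (intro sum.cong) (simp_all add: power2_eq_square)
  also have "\<dots> = (\<Sum>i\<in>A. p i * (1 - p i) / \<sigma> *
      ?E (A - {i}) (\<lambda>k. 1 / \<sigma> * (p i * f' (?x k + 1 / \<sigma>) + (1 - p i) * f' (?x k))))"
  proof (rule sum.cong)
    fix i assume i: "i \<in> A"
    \<comment> \<open>Conditioning on trial \<open>i\<close> passes to the law on
      \<open>A - {i}\<close>, the one that occurs in \<open>xf\<close>.\<close>
    then have "?E A (\<lambda>k. f' (?x k)) =
      p i * ?E (A - {i}) (\<lambda>k. f' (?x (Suc k))) + (1 - p i) * ?E (A - {i}) (\<lambda>k. f' (?x k))"
      using p by (intro expectation_poisson_binomial_remove A) auto
    also have "\<dots> = ?E (A - {i}) (\<lambda>k. p i * f' (?x k + 1 / \<sigma>) + (1 - p i) * f' (?x k))"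
      using A unfolding Suc_x by simp
    finally show "p i * (1 - p i) / \<sigma> * (1 / \<sigma> * ?E A (\<lambda>k. f' (?x k))) = p i * (1 - p i) / \<sigma> *
      ?E (A - {i}) (\<lambda>k. 1 / \<sigma> * (p i * f' (?x k + 1 / \<sigma>) + (1 - p i) * f' (?x k)))"
      by simp
  qed simp
  finally have f': "?E A (\<lambda>k. f' (?x k)) = \<dots>" .
  have "?E A (\<lambda>k. h (?x k)) - integral\<^sup>L std_normal_distribution h =
      ?E A (\<lambda>k. f' (?x k) - ?x k * f (?x k))"
    unfolding eq using A by simp
  also have "\<dots> = ?E A (\<lambda>k. f' (?x k)) - ?E A (\<lambda>k. ?x k * f (?x k))"
    using A by (intro Bochner_Integration.integral_diff integrable_poisson_binomial)
  also have "\<dots> = (\<Sum>i\<in>A. p i * (1 - p i) / \<sigma> * ?E (A - {i}) (?r i))"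
    unfolding f' xf sum_subtractf[symmetric]
  proof (rule sum.cong)
    fix i
    have "?E (A - {i}) (?r i) =
      ?E (A - {i}) (\<lambda>k. 1 / \<sigma> * (p i * f' (?x k + 1 / \<sigma>) + (1 - p i) * f' (?x k))) -
      ?E (A - {i}) (\<lambda>k. f (?x k + 1 / \<sigma>) - f (?x k))"
      using A by (intro Bochner_Integration.integral_diff integrable_poisson_binomial) auto
    then show "p i * (1 - p i) / \<sigma> *
        ?E (A - {i}) (\<lambda>k. 1 / \<sigma> * (p i * f' (?x k + 1 / \<sigma>) + (1 - p i) * f' (?x k))) -
      p i * (1 - p i) / \<sigma> * ?E (A - {i}) (\<lambda>k. f (?x k + 1 / \<sigma>) - f (?x k)) =
      p i * (1 - p i) / \<sigma> * ?E (A - {i}) (?r i)"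
      by (simp only: right_diff_distrib[of "p i * (1 - p i) / \<sigma>", symmetric])
  qed simp
  finally have sum: "?E A (\<lambda>k. h (?x k)) - integral\<^sup>L std_normal_distribution h =
    (\<Sum>i\<in>A. p i * (1 - p i) / \<sigma> * ?E (A - {i}) (?r i))" .
  have "\<bar>\<Sum>i\<in>A. p i * (1 - p i) / \<sigma> * ?E (A - {i}) (?r i)\<bar>
      \<le> (\<Sum>i\<in>A. p i * (1 - p i) / \<sigma> * (2 / \<sigma>\<^sup>2))"
  proof (rule order_trans[OF sum_abs sum_mono])
    fix i assume i: "i \<in> A"
    have r: "\<bar>?r i k\<bar> \<le> 2 / \<sigma>\<^sup>2" for k
    proof -
      \<comment> \<open>Here 4 is the bound on \<open>f''\<close>, and \<open>1 / \<sigma>\<close>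
        is the jump of the standardized sum caused by one success.\<close>
      have "\<bar>?r i k\<bar> \<le> 4 / 2 * (1 / \<sigma>)\<^sup>2"
        by (rule stein_bernoulli_remainder[OF f]) (use p[OF i] in blast)+
      also have "\<dots> = 2 / \<sigma>\<^sup>2" by (simp add: power_divide)
      finally show ?thesis .
    qed
    have "\<bar>?E (A - {i}) (?r i)\<bar> \<le> ?E (A - {i}) (\<lambda>k. \<bar>?r i k\<bar>)"
      by (rule integral_abs_bound)
    also have "\<dots> \<le> ?E (A - {i}) (\<lambda>k. 2 / \<sigma>\<^sup>2)"
      using A by (intro integral_mono r integrable_poisson_binomial) auto
    finally have E: "\<bar>?E (A - {i}) (?r i)\<bar> \<le> 2 / \<sigma>\<^sup>2" by simp
    have c: "0 \<le> p i * (1 - p i) / \<sigma>" using p[OF i] \<sigma>(1) by simp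
    show "\<bar>p i * (1 - p i) / \<sigma> * ?E (A - {i}) (?r i)\<bar> \<le> p i * (1 - p i) / \<sigma> * (2 / \<sigma>\<^sup>2)"
      unfolding abs_mult[of "p i * (1 - p i) / \<sigma>"] abs_of_nonneg[OF c] by (rule mult_left_mono[OF E c])
  qed
  also have "\<dots> = (\<Sum>i\<in>A. p i * (1 - p i)) / \<sigma> * (2 / \<sigma>\<^sup>2)"
    by (simp only: sum_distrib_right sum_divide_distrib)
  also have "\<dots> = 2 / \<sigma>"
    unfolding \<sigma>(2)[symmetric] using \<sigma>(1) by (simp add: power2_eq_square)
  finally show ?thesis unfolding sum .
qed

text \<open>The moving average of \<open>h\<close> over \<open>[x, x + e]\<close> serves: its
  derivative is a difference quotient of \<open>h\<close>, and by the mean value theorem its value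
  is \<open>h z\<close> for some \<open>z\<close> within \<open>e\<close> of
  \<open>x\<close>.\<close>

lemma lipschitz_smooth_approximation:
  fixes h :: "real \<Rightarrow> real"
  assumes h: "1-lipschitz_on UNIV h" and e: "e > 0"
  obtains g g' where "\<And>x. (g has_real_derivative g' x) (at x)" "\<And>x. \<bar>g' x\<bar> \<le> 1"
    "\<And>x. \<bar>g x - h x\<bar> \<le> e"
proof -
  have "isCont h x" for x
    using lipschitz_on_continuous_on[OF h] by (simp add: continuous_on_eq_continuous_at)
  then obtain H where H: "\<And>x. (H has_real_derivative h x) (at x)"
    using einterval_antiderivative[of "-\<infinity>" "\<infinity>" h]
    by (auto simp: has_real_derivative_iff_has_vector_derivative)
  have diff: "\<bar>h y - h x\<bar> \<le> \<bar>y - x\<bar>" for x y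
    using lipschitz_onD[OF h, of y x] by (simp add: dist_real_def)
  define g where "g x = (H (x + e) - H x) / e" for x
  show thesis
  proof (rule that)
    show "(g has_real_derivative (h (x + e) - h x) / e) (at x)" for x
      unfolding g_def[abs_def] using e
      by (auto intro!: derivative_eq_intros DERIV_chain2[OF H] H simp: field_simps)
    show "\<bar>(h (x + e) - h x) / e\<bar> \<le> 1" for x
      using diff[of "x + e" x] e by simp
    show "\<bar>g x - h x\<bar> \<le> e" for x
    proof -
      obtain z where z: "x < z" "z < x + e" "H (x + e) - H x = (x + e - x) * h z"
        using MVT2[of x "x + e" H h] H e by auto
      then have "g x = h z" using e by (simp add: g_def)
      with z diff[of z x] show ?thesis by simp
    qed
  qed
qed

text \<open>Replacing \<open>h\<close> by a smooth function within \<open>e / 2\<close> changes each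
  of the two expectations by at most \<open>e / 2\<close>. Since \<open>e\<close> is arbitrary, the
  smooth bound carries over with the same constant.\<close>

lemma poisson_binomial_normal_approx:
  fixes h :: "real \<Rightarrow> real"
  assumes A: "finite A" and p: "\<And>i. i \<in> A \<Longrightarrow> 0 \<le> p i \<and> p i \<le> 1"
    and \<sigma>: "\<sigma> > 0" "\<sigma>\<^sup>2 = (\<Sum>i\<in>A. p i * (1 - p i))"
    and h: "1-lipschitz_on UNIV h"
  shows "\<bar>measure_pmf.expectation (poisson_binomial A p) (\<lambda>k. h ((real k - (\<Sum>i\<in>A. p i)) / \<sigma>)) -
    integral\<^sup>L std_normal_distribution h\<bar> \<le> 2 / \<sigma>"
proof (rule field_le_epsilon)
  fix e :: real assume "e > 0"
  then obtain g g' where g: "\<And>x. (g has_real_derivative g' x) (at x)" "\<And>x. \<bar>g' x\<bar> \<le> 1"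
    and gh: "\<And>x. \<bar>g x - h x\<bar> \<le> e / 2"
    using lipschitz_smooth_approximation[OF h, of "e / 2"] by (metis half_gt_zero)
  interpret N: prob_space std_normal_distribution
    by (rule prob_space_normal_density) simp
  let ?P = "measure_pmf (poisson_binomial A p)"
  let ?x = "\<lambda>k. (real k - (\<Sum>i\<in>A. p i)) / \<sigma>"
  have close: "\<bar>integral\<^sup>L M (\<lambda>x. g (X x)) - integral\<^sup>L M (\<lambda>x. h (X x))\<bar> \<le> e / 2"
    if "prob_space M" "integrable M (\<lambda>x. g (X x))" "integrable M (\<lambda>x. h (X x))"
    for M :: "'c measure" and X
  proof -
    interpret prob_space M by fact
    have "\<bar>integral\<^sup>L M (\<lambda>x. g (X x)) - integral\<^sup>L M (\<lambda>x. h (X x))\<bar> =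
        \<bar>LINT x|M. g (X x) - h (X x)\<bar>"
      using that by simp
    also have "\<dots> \<le> (LINT x|M. \<bar>g (X x) - h (X x)\<bar>)" by (rule integral_abs_bound)
    also have "\<dots> \<le> (LINT x|M. e / 2)"
      using that by (intro integral_mono gh) auto
    finally show ?thesis by (simp add: prob_space)
  qed
  have "\<bar>(LINT k|?P. g (?x k)) - (LINT k|?P. h (?x k))\<bar> \<le> e / 2"
    using A by (intro close measure_pmf.prob_space_axioms integrable_poisson_binomial)
  moreover have "\<bar>integral\<^sup>L std_normal_distribution g - integral\<^sup>L std_normal_distribution h\<bar> \<le> e / 2"
    using close[of std_normal_distribution "\<lambda>x. x"] N.prob_space_axioms h lipschitz_one_derivative[OF g]
    by (auto intro: integrable_std_normal_lipschitz)
  moreover have "\<bar>(LINT k|?P. g (?x k)) - integral\<^sup>L std_normal_distribution g\<bar> \<le> 2 / \<sigma>"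
    by (rule poisson_binomial_normal_approx_smooth[OF A p \<sigma> g])
  ultimately show "\<bar>(LINT k|?P. h (?x k)) - integral\<^sup>L std_normal_distribution h\<bar> \<le> 2 / \<sigma> + e"
    by linarith
qed

section \<open>Branches of weighted recursive trees\<close>

text \<open>This makes node \<open>Suc n\<close> fresh in a tree of size \<open>n\<close> and the
  sets of children finite, so that a new child of the root raises the cardinality in
  \<open>branches\<close> by exactly one.\<close>

lemma set_pmf_wrt: "t \<in> set_pmf (wrt w n) \<Longrightarrow> t \<subseteq> UNIV \<times> {..n} \<and> finite t"
proof (induction w n arbitrary: t rule: wrt.induct)
  case (3 w m)
  then obtain s i where "s \<in> set_pmf (wrt w (Suc m))" "t = insert (i, Suc (Suc m)) s" by auto
  with "3.IH"[of s] show ?case by (auto simp: le_Suc_eq)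
qed auto

lemma branches_insert:
  assumes "t \<subseteq> UNIV \<times> {..n}" "finite t"
  shows "branches (insert (i, Suc n) t) = of_bool (i = 1) + branches t"
proof -
  have "children (insert (i, Suc n) t) 1 =
      (if i = 1 then insert (Suc n) (children t 1) else children t 1)"
    by (auto simp: children_def)
  moreover have "Suc n \<notin> children t 1" using assms by (auto simp: children_def)
  moreover have "finite (children t 1)"
    using finite_imageI[OF assms(2), of snd] by (rule rev_finite_subset) (force simp: children_def)
  ultimately show ?thesis by (simp add: branches_def)
qed

lemma pmf_bool_eqI:
  fixes M N :: "bool pmf"
  assumes "pmf M True = pmf N True"
  shows "M = N"
proof (rule pmf_eqI)
  have "pmf M False = 1 - pmf M True" for M :: "bool pmf"
    using sum_pmf_eq_1[of UNIV M] subset_UNIV[of "set_pmf M"] by (simp add: UNIV_bool)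
  with assms show "pmf M b = pmf N b" for b by (cases b) auto
qed

text \<open>\<open>cts_step a b\<close> falls linearly from 1 to 0 between \<open>a\<close> and
  \<open>b\<close>. Rescaled to slope -1 it is a test function for the Lipschitz bound, and such
  steps suffice for weak convergence.\<close>

lemma cts_step_lipschitz:
  assumes "a < b"
  shows "1-lipschitz_on UNIV (\<lambda>x. (b - a) * cts_step a b x)"
proof (rule lipschitz_onI)
  fix x y :: real
  have "(b - a) * cts_step a b x = (if x \<le> a then b - a else if x \<ge> b then 0 else b - x)" for x
    using assms by (simp add: cts_step_def)
  with assms show "dist ((b - a) * cts_step a b x) ((b - a) * cts_step a b y) \<le> 1 * dist x y"
    by (simp add: dist_real_def abs_minus_commute)
qed simp

text \<open>The index is the size of the tree that the new node joins, so the value concerns node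
  \<open>Suc i\<close>.\<close>

definition root_prob :: "(nat \<Rightarrow> real) \<Rightarrow> nat \<Rightarrow> real" where
  "root_prob w i = w 1 / (\<Sum>k=1..i. w k)"

locale positive_weights =
  fixes w :: "nat \<Rightarrow> real"
  assumes pos: "i \<ge> 1 \<Longrightarrow> w i > 0"
begin

section \<open>Attachment probabilities of the root\<close>

lemma root_prob_pos: "i \<ge> 1 \<Longrightarrow> 0 < root_prob w i"
  using pos by (auto simp: root_prob_def intro!: divide_pos_pos sum_pos)

text \<open>The total weight only grows. With the values at 1 and 2 this bounds all parameters by 1,
  and those from the second on by a constant below 1.\<close>

lemma root_prob_antimono:
  assumes "1 \<le> i" "i \<le> j"
  shows "root_prob w j \<le> root_prob w i"
proof -
  have "(\<Sum>k=1..i. w k) \<le> (\<Sum>k=1..j. w k)"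
    using assms pos by (intro sum_mono2) (auto intro: less_imp_le)
  moreover have "0 < (\<Sum>k=1..i. w k)" using assms pos by (intro sum_pos) auto
  moreover have "0 < w 1" using pos by simp
  ultimately show ?thesis unfolding root_prob_def by (intro divide_left_mono mult_pos_pos) auto
qed

text \<open>Node 2 can only choose the root, so the first trial is deterministic: it adds 1 to the
  mean and nothing to the variance.\<close>

lemma root_prob_1: "root_prob w 1 = 1"
  using pos[of 1] by (simp add: root_prob_def)

lemma root_prob_le_1: "i \<ge> 1 \<Longrightarrow> root_prob w i \<le> 1"
  using root_prob_antimono[of 1 i] root_prob_1 by simp

lemma root_prob_2: "root_prob w 2 < 1"
  using pos[of 1] pos[of 2] by (simp add: root_prob_def numeral_2_eq_2)

lemma root_prob_bounds: "i \<in> {1..m} \<Longrightarrow> 0 \<le> root_prob w i \<and> root_prob w i \<le> 1"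
  using root_prob_pos[of i] root_prob_le_1[of i] by simp

lemma map_pmf_attachment:
  assumes m: "m \<ge> 1"
  shows "map_pmf (\<lambda>i. i = 1) (attachment w m) = bernoulli_pmf (root_prob w m)"
proof (rule pmf_bool_eqI)
  have "pmf (map_pmf (\<lambda>i. i = 1) (attachment w m)) True = pmf (attachment w m) (1::nat)"
    by (simp add: pmf_map vimage_def measure_pmf_single)
  also have "\<dots> = root_prob w m"
    using m pmf_attachment[of w m 1] pos by (simp add: root_prob_def)
  also have "\<dots> = pmf (bernoulli_pmf (root_prob w m)) True"
    using root_prob_pos[OF m] root_prob_le_1[OF m] by simp
  finally show "pmf (map_pmf (\<lambda>i. i = 1) (attachment w m)) True =
      pmf (bernoulli_pmf (root_prob w m)) True" .
qed

text \<open>The new node is fresh, so the count changes only through the event that the root is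
  drawn as parent. The law of that draw does not depend on the tree, hence each step adds one
  independent Bernoulli trial.\<close>

lemma branches_law:
  "map_pmf branches (wrt w (Suc m)) = poisson_binomial {1..m} (root_prob w)"
proof (induction m)
  case 0
  show ?case by (simp add: poisson_binomial_empty branches_def children_def)
next
  case (Suc m)
  have "map_pmf branches (wrt w (Suc (Suc m))) =
    bind_pmf (wrt w (Suc m)) (\<lambda>t. bind_pmf (attachment w (Suc m))
      (\<lambda>i. return_pmf (of_bool (i = 1) + branches t)))"
    unfolding wrt.simps map_bind_pmf map_return_pmf
    by (intro bind_pmf_cong refl) (use set_pmf_wrt branches_insert in \<open>blast intro: arg_cong[where f=return_pmf]\<close>)
  \<comment> \<open>The two independent draws are exchanged; with the parent drawn first, the
    expression has the shape of \<open>poisson_binomial_insert\<close>.\<close>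
  also have "\<dots> = bind_pmf (map_pmf (\<lambda>i. i = 1) (attachment w (Suc m)))
      (\<lambda>c. map_pmf (\<lambda>k. of_bool c + k) (map_pmf branches (wrt w (Suc m))))"
    by (subst bind_commute_pmf)
      (simp add: map_pmf_def bind_assoc_pmf bind_return_pmf)
  also have "\<dots> = poisson_binomial (insert (Suc m) {1..m}) (root_prob w)"
    using map_pmf_attachment[of "Suc m"] by (subst poisson_binomial_insert) (simp_all add: Suc)
  also have "insert (Suc m) {1..m} = {1..Suc m}" by auto
  finally show ?case .
qed

section \<open>Mean and variance of the number of branches\<close>

lemma expectation_branches:
  fixes g :: "nat \<Rightarrow> real"
  shows "measure_pmf.expectation (wrt w (Suc m)) (\<lambda>t. g (branches t)) =
    measure_pmf.expectation (poisson_binomial {1..m} (root_prob w)) g"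
  unfolding branches_law[symmetric] by simp

lemma mean_branches_Suc: "mean_branches w (Suc m) = (\<Sum>i=1..m. root_prob w i)"
  unfolding mean_branches_def expectation_branches
  by (rule mean_poisson_binomial) (use root_prob_bounds in auto)

lemma var_branches_Suc: "var_branches w (Suc m) = (\<Sum>i=1..m. root_prob w i * (1 - root_prob w i))"
proof -
  \<comment> \<open>The centre of the variance is itself an expectation over trees, so the outer
    integral is rewritten for an arbitrary centre \<open>c\<close>.\<close>
  have "var_branches w (Suc m) = measure_pmf.variance (poisson_binomial {1..m} (root_prob w)) real"
    unfolding var_branches_def
    by (simp only: expectation_branches[of m "\<lambda>k. (real k - c)\<^sup>2" for c] expectation_branches[of m real])
  also have "\<dots> = (\<Sum>i=1..m. root_prob w i * (1 - root_prob w i))"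
    by (rule variance_poisson_binomial) (use root_prob_bounds in auto)
  finally show ?thesis .
qed

lemma mean_branches_eq:
  assumes "n \<ge> 2"
  shows "mean_branches w n = (\<Sum>i=1..n-1. root_prob w i)"
  using assms mean_branches_Suc[of "n - 1"] by simp

lemma var_branches_eq:
  assumes "n \<ge> 2"
  shows "var_branches w n = (\<Sum>i=2..n-1. root_prob w i * (1 - root_prob w i))"
proof -
  \<comment> \<open>The summand of index 1 vanishes through its factor
    \<open>1 - root_prob w 1\<close>.\<close>
  have "{1..n-1} = insert 1 {2..n-1}" using assms by auto
  then show ?thesis
    using assms var_branches_Suc[of "n - 1"] root_prob_1 by simp
qed

text \<open>From index 2 on all parameters lie strictly between 0 and 1, and
  \<open>n \<ge> 3\<close> makes the sum nonempty.\<close>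

lemma var_branches_pos:
  assumes "n \<ge> 3"
  shows "0 < var_branches w n"
proof -
  have "root_prob w i < 1" if "i \<ge> 2" for i
    using root_prob_antimono[of 2 i] root_prob_2 that by simp
  then show ?thesis
    using assms root_prob_pos by (subst var_branches_eq) (auto intro!: sum_pos mult_pos_pos)
qed

text \<open>Termwise, \<open>1 - root_prob w i\<close> is at least \<open>1 - root_prob w 2\<close>;
  subtracting 1 from the mean discards the deterministic first trial. A diverging mean thus forces a
  diverging variance.\<close>

lemma var_branches_ge_mean:
  assumes "n \<ge> 2"
  shows "(1 - root_prob w 2) * (mean_branches w n - 1) \<le> var_branches w n"
proof -
  have "{1..n-1} = insert 1 {2..n-1}" using assms by auto
  then have "(1 - root_prob w 2) * (mean_branches w n - 1) =
      (\<Sum>i=2..n-1. (1 - root_prob w 2) * root_prob w i)"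
    using assms root_prob_1 by (simp add: mean_branches_eq sum_distrib_left)
  also have "\<dots> \<le> (\<Sum>i=2..n-1. root_prob w i * (1 - root_prob w i))"
  proof (rule sum_mono)
    fix i assume "i \<in> {2..n-1}"
    then have "root_prob w i \<le> root_prob w 2" "0 < root_prob w i"
      using root_prob_antimono root_prob_pos by auto
    then show "(1 - root_prob w 2) * root_prob w i \<le> root_prob w i * (1 - root_prob w i)"
      by (simp add: mult.commute)
  qed
  finally show ?thesis using assms by (simp add: var_branches_eq)
qed

section \<open>Normal approximation and weak convergence of the standardized count\<close>

lemma standardized_branches_normal_approx:
  fixes h :: "real \<Rightarrow> real"
  assumes n: "n \<ge> 3" and h: "1-lipschitz_on UNIV h"
  shows "\<bar>integral\<^sup>L (standardized_branches_law w n) h - integral\<^sup>L std_normal_distribution h\<bar>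
    \<le> 2 / sqrt (var_branches w n)"
proof -
  obtain m where m: "n = Suc m" using n by (cases n) auto
  have "integral\<^sup>L (standardized_branches_law w n) h = measure_pmf.expectation (wrt w n)
      (\<lambda>t. h ((real (branches t) - mean_branches w n) / sqrt (var_branches w n)))"
    unfolding standardized_branches_law_def
    using lipschitz_measurable[OF h] by (intro integral_distr) auto
  also have "\<dots> = measure_pmf.expectation (poisson_binomial {1..m} (root_prob w))
      (\<lambda>k. h ((real k - (\<Sum>i=1..m. root_prob w i)) / sqrt (var_branches w n)))"
    unfolding m mean_branches_Suc by (rule expectation_branches)
  finally have eq: "integral\<^sup>L (standardized_branches_law w n) h = \<dots>" .
  show ?thesis unfolding eq
  proof (rule poisson_binomial_normal_approx)
    show "0 < sqrt (var_branches w n)" using var_branches_pos[OF n] by simp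
    show "(sqrt (var_branches w n))\<^sup>2 = (\<Sum>i=1..m. root_prob w i * (1 - root_prob w i))"
      using var_branches_pos[OF n] by (simp add: m var_branches_Suc)
  qed (use root_prob_bounds h in auto)
qed

lemma weak_conv_standardized_branches:
  assumes mean: "filterlim (mean_branches w) at_top sequentially"
  shows "weak_conv_m (standardized_branches_law w) std_normal_distribution"
proof (rule integral_cts_step_conv_imp_weak_conv)
  show "real_distribution (standardized_branches_law w n)" for n
    unfolding standardized_branches_law_def
    by (rule prob_space.real_distribution_distr) (auto intro: measure_pmf.prob_space_axioms)
  show "real_distribution std_normal_distribution" by (rule real_dist_normal_dist)
  fix a b :: real assume ab: "a < b"
  let ?I = "\<lambda>n. integral\<^sup>L (standardized_branches_law w n) (cts_step a b)"
  let ?N = "integral\<^sup>L std_normal_distribution (cts_step a b)"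
  \<comment> \<open>The lower bound for the variance diverges because its factor
    \<open>1 - root_prob w 2\<close> is a positive constant.\<close>
  have "filterlim (\<lambda>n. - 1 + mean_branches w n) at_top sequentially"
    by (rule filterlim_tendsto_add_at_top[OF tendsto_const mean])
  then have "filterlim (\<lambda>n. (1 - root_prob w 2) * (mean_branches w n - 1)) at_top sequentially"
    using root_prob_2 by (intro filterlim_tendsto_pos_mult_at_top[OF tendsto_const]) simp_all
  then have var: "filterlim (var_branches w) at_top sequentially"
    by (rule filterlim_at_top_mono)
      (auto intro!: eventually_sequentiallyI[of 2] var_branches_ge_mean)
  have "(\<lambda>n. 2 / sqrt (var_branches w n)) \<longlonglongrightarrow> 0"
    by (intro real_tendsto_divide_at_top[OF tendsto_const] filterlim_compose[OF sqrt_at_top var])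
  then have lim: "(\<lambda>n. 2 / sqrt (var_branches w n) / (b - a)) \<longlonglongrightarrow> 0"
    by (rule tendsto_divide_zero)
  have "(\<lambda>n. ?I n - ?N) \<longlonglongrightarrow> 0"
  proof (rule Lim_null_comparison[OF _ lim])
    show "\<forall>\<^sub>F n in sequentially. norm (?I n - ?N) \<le> 2 / sqrt (var_branches w n) / (b - a)"
    proof (rule eventually_sequentiallyI[of 3])
      fix n :: nat assume "3 \<le> n"
      \<comment> \<open>The bound concerns the step scaled by \<open>b - a\<close>; undoing the
        scaling costs a factor that is fixed as \<open>n\<close> grows.\<close>
      from standardized_branches_normal_approx[OF this cts_step_lipschitz[OF ab]]
      have "\<bar>(b - a) * (?I n - ?N)\<bar> \<le> 2 / sqrt (var_branches w n)"
        by (simp add: right_diff_distrib)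
      with ab show "norm (?I n - ?N) \<le> 2 / sqrt (var_branches w n) / (b - a)"
        by (subst pos_le_divide_eq) (simp_all add: abs_mult mult.commute)
    qed
  qed
  then show "?I \<longlonglongrightarrow> ?N" by (simp add: LIM_zero_iff)
qed

end

theorem theorem6p1:
  fixes w :: "nat \<Rightarrow> real"
  assumes pos: "\<And>i. i \<ge> 1 \<Longrightarrow> w i > 0"
  shows
    "(\<forall>n\<ge>2.
        mean_branches w n = (\<Sum>i=1..n-1. w 1 / (\<Sum>k=1..i. w k)) \<and>
        var_branches w n =
          (\<Sum>i=2..n-1. w 1 / (\<Sum>k=1..i. w k) * (1 - w 1 / (\<Sum>k=1..i. w k)))) \<and>
     (filterlim (mean_branches w) at_top sequentially \<longrightarrow>
        weak_conv_m (standardized_branches_law w) std_normal_distribution) \<and>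
     (\<forall>n\<ge>3.
        wasserstein_dist (standardized_branches_law w n) std_normal_distribution
          \<le> ennreal (1 / sqrt (var_branches w n) * ((sqrt 28 + sqrt pi) / sqrt pi)))"
proof -
  interpret positive_weights w by unfold_locales (fact pos)
  have "wasserstein_dist (standardized_branches_law w n) std_normal_distribution
      \<le> ennreal (1 / sqrt (var_branches w n) * ((sqrt 28 + sqrt pi) / sqrt pi))"
    if n: "n \<ge> 3" for n
  proof -
    \<comment> \<open>The claimed constant is \<open>sqrt 28 / sqrt pi + 1\<close>, which is at
      least 2 as \<pi> is below 28, so the bound with constant 2 implies it.\<close>
    have "sqrt pi \<le> sqrt 28" using pi_less_4 by (intro real_sqrt_le_mono) simp
    then have "2 \<le> (sqrt 28 + sqrt pi) / sqrt pi" by (simp add: pos_le_divide_eq)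
    then have "1 / sqrt (var_branches w n) * 2
        \<le> 1 / sqrt (var_branches w n) * ((sqrt 28 + sqrt pi) / sqrt pi)"
      using var_branches_pos[OF n] by (intro mult_left_mono) auto
    then show ?thesis
      unfolding wasserstein_dist_def using standardized_branches_normal_approx[OF n]
      by (intro SUP_least ennreal_leI) force
  qed
  then show ?thesis
    using mean_branches_eq var_branches_eq weak_conv_standardized_branches
    by (simp add: root_prob_def)
qed

end
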